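(* Let $\{g_n\}_{n=0}^\infty$ be a stable normalized tight frame, with $\|g_0\|=1$, in a Hilbert space $\mathcal H$. Then there exists a unique admissible effective sequence $\{e_n\}_{n=0}^\infty$ of unit vectors in $\mathcal H$ such that $$g_0=e_0,\qquad g_n=e_n-\sum_{i=0}^{n-1}\langle e_n,e_i\rangle g_i\quad (n\ge 1).$$ Moreover, the sequence $\{e_n\}_{n=0}^\infty$ is stable.
   Context: Hilbert spaces are complex, with inner product linear in the first variable. A set of vectors is linearly dense if its linear span is dense in $\mathcal H$. A sequence $\{g_n\}_{n=0}^\infty$ in $\mathcal H$ is a normalized tight frame if $\sum_{n=0}^\infty |\langle x,g_n\rangle|^2= \|x\|^2$ for all $x\in\mathcal H$. Such a sequence (with $\|g_0\|=1$) is stable if for every $N$ the set $\{g_0\}\cup\{g_n\}_{n=N}^\infty$ is linearly dense. A sequence of unit vectors $\{e_n\}_{n=0}^\infty$ is stable if for every $N$ the set $\{e_n\}_{n=N}^\infty$ is linearly dense; it is admissible if $\langle e_n,e_{n+1}\rangle\ge 0$ (i.e. is real and nonnegative) for all $n\ge 0$. Given a linearly dense sequence $\{e_n\}_{n=0}^\infty$ of unit vectors and $x\in\mathcal H$, the Kaczmarz algorithm defines $x_0=\langle x,e_0\rangle e_0$ and $x_n=x_{n-1}+\langle x-x_{n-1},e_n\rangle e_n$ for $n\ge1$; the sequence $\{e_n\}_{n=0}^\infty$ is effective if $x_n\to x$ in norm for every $x\in\mathcal H$. *)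

theory Defs
  imports "HOL-Analysis.Analysis" "HOL-Library.Nonpos_Ints"
begin

text \<open>
  Complex Hilbert spaces as a type class on top of \<^class>\<open>real_normed_vector\<close>; the real structure
  is the restriction of the complex one. The instance for \<^typ>\<open>complex\<close> below only witnesses that
  the axioms are satisfiable.
\<close>

class complex_vector = real_vector +
  fixes scaleC :: "complex \<Rightarrow> 'a \<Rightarrow> 'a" (infixr "*\<^sub>C" 75)
  assumes scaleC_add_right: "a *\<^sub>C (x + y) = a *\<^sub>C x + a *\<^sub>C y"
    and scaleC_add_left: "(a + b) *\<^sub>C x = a *\<^sub>C x + b *\<^sub>C x"
    and scaleC_scaleC: "a *\<^sub>C (b *\<^sub>C x) = (a * b) *\<^sub>C x"
    and scaleC_one: "1 *\<^sub>C x = x"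
    and scaleR_scaleC: "r *\<^sub>R x = complex_of_real r *\<^sub>C x"

text \<open>The inner product is linear in the first variable.\<close>

class complex_inner = complex_vector + real_normed_vector +
  fixes cinner :: "'a \<Rightarrow> 'a \<Rightarrow> complex"
  assumes cinner_commute: "cinner x y = cnj (cinner y x)"
    and cinner_add_left: "cinner (x + y) z = cinner x z + cinner y z"
    and cinner_scaleC_left: "cinner (a *\<^sub>C x) y = a * cinner x y"
    and cinner_self: "cinner x x = complex_of_real ((norm x)\<^sup>2)"

class chilbert_space = complex_inner + complete_space

instantiation complex :: chilbert_space
begin

definition scaleC_complex :: "complex \<Rightarrow> complex \<Rightarrow> complex"
  where "scaleC_complex a x = a * x"

definition cinner_complex :: "complex \<Rightarrow> complex \<Rightarrow> complex"
  where "cinner_complex x y = x * cnj y"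

instance
  by standard
    (auto simp: scaleC_complex_def cinner_complex_def algebra_simps scaleR_conv_of_real
      complex_norm_square simp del: of_real_power)

end

global_interpretation complex_vector: vector_space "scaleC :: complex \<Rightarrow> 'a \<Rightarrow> 'a::complex_vector"
  by standard (simp_all add: scaleC_add_right scaleC_add_left scaleC_scaleC scaleC_one)

definition linearly_dense :: "'a::complex_inner set \<Rightarrow> bool"
  where "linearly_dense S \<longleftrightarrow> closure (complex_vector.span S) = UNIV"

definition normalized_tight_frame :: "(nat \<Rightarrow> 'a::complex_inner) \<Rightarrow> bool"
  where "normalized_tight_frame g \<longleftrightarrow> (\<forall>x. (\<lambda>n. (cmod (cinner x (g n)))\<^sup>2) sums (norm x)\<^sup>2)"

text \<open>
  Stability means different things for frames and for sequences of unit vectors: for a frame the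
  initial vector is always kept. The predicates below do not include the normalizations
  \<open>norm (g 0) = 1\<close> and \<open>norm (e n) = 1\<close>, which are stated separately.
\<close>

definition stable_frame :: "(nat \<Rightarrow> 'a::complex_inner) \<Rightarrow> bool"
  where "stable_frame g \<longleftrightarrow> (\<forall>N. linearly_dense ({g 0} \<union> g ` {N..}))"

definition stable_sequence :: "(nat \<Rightarrow> 'a::complex_inner) \<Rightarrow> bool"
  where "stable_sequence e \<longleftrightarrow> (\<forall>N. linearly_dense (e ` {N..}))"

definition admissible_sequence :: "(nat \<Rightarrow> 'a::complex_inner) \<Rightarrow> bool"
  where "admissible_sequence e \<longleftrightarrow> (\<forall>n. cinner (e n) (e (Suc n)) \<in> \<real>\<^sub>\<ge>\<^sub>0)"

primrec kaczmarz :: "(nat \<Rightarrow> 'a::complex_inner) \<Rightarrow> 'a \<Rightarrow> nat \<Rightarrow> 'a"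
  where
    "kaczmarz e x 0 = cinner x (e 0) *\<^sub>C e 0"
  | "kaczmarz e x (Suc n) =
      kaczmarz e x n + cinner (x - kaczmarz e x n) (e (Suc n)) *\<^sub>C e (Suc n)"

definition effective_sequence :: "(nat \<Rightarrow> 'a::complex_inner) \<Rightarrow> bool"
  where "effective_sequence e \<longleftrightarrow>
    linearly_dense (range e) \<and> (\<forall>x. (\<lambda>n. kaczmarz e x n) \<longlonglongrightarrow> x)"

end

theory Submission imports Defs begin

text \<open>
  For sequences \<open>e\<close> and \<open>g\<close> put
  \<open>B\<^sub>n x = x - (\<Sum>i<n. \<langle>x, g\<^sub>i\<rangle> e\<^sub>i)\<close> and \<open>A\<^sub>n v = v - (\<Sum>i<n. \<langle>v, e\<^sub>i\<rangle> g\<^sub>i)\<close>.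
  These operators are adjoint to each other, and the recursion linking the two sequences reads
  \<open>A\<^sub>n e\<^sub>n = g\<^sub>n\<close>. It says exactly that \<open>\<langle>x, g\<^sub>n\<rangle> = \<langle>B\<^sub>n x, e\<^sub>n\<rangle>\<close>, so that \<open>B\<^sub>n\<^sub>+\<^sub>1\<close> is
  \<open>B\<^sub>n\<close> followed by the projection onto the orthogonal complement of \<open>e\<^sub>n\<close>. Hence
  \<open>B\<^sub>n\<^sub>+\<^sub>1 x\<close> is the error after step \<open>n\<close> of the Kaczmarz algorithm, and Pythagoras gives
  \<open>\<parallel>B\<^sub>n x\<parallel>\<^sup>2 = \<parallel>x\<parallel>\<^sup>2 - (\<Sum>i<n. \<bar>\<langle>x, g\<^sub>i\<rangle>\<bar>\<^sup>2)\<close> (lemma \<open>norm_deflate_squared\<close>). For a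
  normalized tight frame the right-hand side is a tail of a convergent series, so every unit
  sequence satisfying the recursion is effective.

  What remains is to solve \<open>A\<^sub>n\<^sub>+\<^sub>1 r = g\<^sub>n\<^sub>+\<^sub>1\<close> by a unit vector \<open>r\<close>. The key is the
  predicate \<open>one_dim_defect\<close>: the kernel of \<open>A\<^sub>n\<^sub>+\<^sub>1\<close> is the line through \<open>e\<^sub>n\<close>, the range of
  \<open>B\<^sub>n\<^sub>+\<^sub>1\<close> is the orthogonal complement of \<open>e\<^sub>n\<close>, and the range of \<open>A\<^sub>n\<^sub>+\<^sub>1\<close> is the
  orthogonal complement of \<open>g\<^sub>0\<close>. It passes from \<open>n\<close> to \<open>n + 1\<close> as soon as
  \<open>\<langle>e\<^sub>n, e\<^sub>n\<^sub>+\<^sub>1\<rangle> \<noteq> 0\<close>. This is where stability enters: by the norm identity the kernel of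
  \<open>B\<^sub>n\<close> is orthogonal to all \<open>g\<^sub>m\<close> with \<open>m \<ge> n\<close>, so stability confines it to the line
  through \<open>g\<^sub>0\<close> (\<open>kernel_deflate\<close>), whereas \<open>\<langle>e\<^sub>n, e\<^sub>n\<^sub>+\<^sub>1\<rangle> = 0\<close> would put a second direction
  into the kernel of \<open>B\<^sub>n\<^sub>+\<^sub>2\<close> (\<open>consecutive_not_orthogonal\<close>).

  Since \<open>g\<^sub>n\<^sub>+\<^sub>1\<close> is orthogonal to \<open>g\<^sub>0\<close>, the equation has a solution \<open>y\<close> orthogonal to \<open>e\<^sub>n\<close>,
  unique with that property, and its norm is at most 1. The unit solutions are the vectors
  \<open>y + c e\<^sub>n\<close> with \<open>\<bar>c\<bar>\<^sup>2 = 1 - \<parallel>y\<parallel>\<^sup>2\<close>, and admissibility selects the one with \<open>c \<ge> 0\<close>.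

  Finally, a vector orthogonal to \<open>e\<^sub>n\<close> equals \<open>B\<^sub>n\<^sub>+\<^sub>1 x\<close> for some \<open>x\<close>, and since the errors
  tend to 0 it is the sum of the remaining Kaczmarz corrections, which are multiples of
  \<open>e\<^sub>m\<close> with \<open>m > n\<close>. As \<open>e\<^sub>n\<^sub>+\<^sub>1\<close> is not orthogonal to \<open>e\<^sub>n\<close>, adding a multiple of it
  reaches every vector, which is stability of \<open>e\<close>.
\<close>

section \<open>Complex inner products\<close>

lemma cinner_zero_left [simp]: "cinner 0 y = 0"
  using cinner_add_left[of 0 0 y] by simp

lemma cinner_zero_right [simp]: "cinner x 0 = 0"
  by (subst cinner_commute) simp

lemma cinner_minus_left: "cinner (- x) y = - cinner x y"
  using cinner_add_left[of x "- x" y] by (simp add: eq_neg_iff_add_eq_0 add.commute)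

lemma cinner_diff_left: "cinner (x - y) z = cinner x z - cinner y z"
  using cinner_add_left[of x "- y" z] by (simp add: cinner_minus_left)

lemma cinner_add_right: "cinner x (y + z) = cinner x y + cinner x z"
  by (metis cinner_commute cinner_add_left complex_cnj_add)

lemma cinner_diff_right: "cinner x (y - z) = cinner x y - cinner x z"
  by (metis cinner_commute cinner_diff_left complex_cnj_diff)

lemma cinner_scaleC_right: "cinner x (a *\<^sub>C y) = cnj a * cinner x y"
  by (metis cinner_commute cinner_scaleC_left complex_cnj_mult)

lemma cinner_eq_zero_commute: "cinner x y = 0 \<longleftrightarrow> cinner y x = 0"
  by (metis cinner_commute complex_cnj_zero)

lemma cmod_cinner_commute: "cmod (cinner x y) = cmod (cinner y x)"
  by (metis cinner_commute complex_mod_cnj)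

lemma norm_eq_1_iff_cinner: "norm (x :: 'a :: complex_inner) = 1 \<longleftrightarrow> cinner x x = 1"
proof
  assume "cinner x x = 1"
  then have "(norm x)\<^sup>2 = 1"
    by (metis cinner_self of_real_eq_1_iff)
  then show "norm x = 1"
    by (simp add: power2_eq_1_iff) (metis norm_ge_zero not_one_le_zero order.trans zero_le_one neg_0_le_iff_le)
qed (simp add: cinner_self)

lemma norm_diff_projection_squared:
  fixes e :: "'a :: complex_inner"
  assumes "norm e = 1"
  shows "(norm (x - cinner x e *\<^sub>C e))\<^sup>2 = (norm x)\<^sup>2 - (cmod (cinner x e))\<^sup>2"
proof -
  have "cinner e e = 1"
    using assms by (simp add: norm_eq_1_iff_cinner)
  then have "cinner (x - cinner x e *\<^sub>C e) (x - cinner x e *\<^sub>C e)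
      = cinner x x - cinner x e * cinner e x"
    by (simp add: cinner_diff_left cinner_diff_right cinner_scaleC_left cinner_scaleC_right
        algebra_simps)
  also have "cinner e x = cnj (cinner x e)"
    by (rule cinner_commute)
  finally have "complex_of_real ((norm (x - cinner x e *\<^sub>C e))\<^sup>2)
      = complex_of_real ((norm x)\<^sup>2 - (cmod (cinner x e))\<^sup>2)"
    by (simp add: cinner_self complex_norm_square del: of_real_power)
  then show ?thesis
    using of_real_eq_iff by blast
qed

lemma norm_orthogonal_add_squared:
  fixes x :: "'a :: complex_inner"
  assumes "cinner x y = 0"
  shows "(norm (x + y))\<^sup>2 = (norm x)\<^sup>2 + (norm y)\<^sup>2"
proof -
  have "cinner y x = 0"
    using assms cinner_eq_zero_commute by blast
  then have "cinner (x + y) (x + y) = cinner x x + cinner y y"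
    using assms by (simp add: cinner_add_left cinner_add_right)
  then have "complex_of_real ((norm (x + y))\<^sup>2) = complex_of_real ((norm x)\<^sup>2 + (norm y)\<^sup>2)"
    by (simp add: cinner_self)
  then show ?thesis
    using of_real_eq_iff by blast
qed

lemma projection_residual_orthogonal:
  fixes e :: "'a :: complex_inner"
  assumes "norm e = 1"
  shows "cinner (x - cinner x e *\<^sub>C e) e = 0"
  using assms by (simp add: norm_eq_1_iff_cinner cinner_diff_left cinner_scaleC_left)

lemma ex_orthogonal_correction:
  fixes a b :: "'a :: complex_inner"
  assumes "cinner a b \<noteq> 0"
  shows "\<exists>c. cinner (v - c *\<^sub>C a) b = 0"
  using assms by (intro exI[of _ "cinner v b / cinner a b"])
    (simp add: cinner_diff_left cinner_scaleC_left)

text \<open>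
  Any \<open>s\<close> in the span is orthogonal to \<open>w\<close> and therefore at distance at least \<open>\<parallel>w\<parallel>\<close> from it,
  while density provides arbitrarily close ones.
\<close>

lemma orthogonal_to_linearly_dense_eq_0:
  fixes w :: "'a :: complex_inner"
  assumes "linearly_dense S" and orth: "\<And>s. s \<in> S \<Longrightarrow> cinner s w = 0"
  shows "w = 0"
proof (rule ccontr)
  assume "w \<noteq> 0"
  moreover have "w \<in> closure (complex_vector.span S)"
    using assms(1) by (simp add: linearly_dense_def)
  ultimately obtain s where s: "s \<in> complex_vector.span S" and near: "dist s w < norm w"
    by (metis closure_approachable zero_less_norm_iff)
  have "complex_vector.subspace {s. cinner s w = 0}"
    by (simp add: complex_vector.subspace_def cinner_add_left cinner_scaleC_left)
  then have "cinner s w = 0"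
    using complex_vector.span_minimal[of S "{s. cinner s w = 0}"] orth s by blast
  then have "cinner s (- w) = 0"
    using cinner_diff_right[of s 0 w] by simp
  then have "(norm (s - w))\<^sup>2 = (norm s)\<^sup>2 + (norm w)\<^sup>2"
    using norm_orthogonal_add_squared[of s "- w"] by simp
  then have "(norm w)\<^sup>2 \<le> (norm (s - w))\<^sup>2"
    by simp
  then have "norm w \<le> norm (s - w)"
    by (rule power2_le_imp_le) simp
  then show False
    using near by (simp add: dist_norm)
qed

section \<open>Finite-rank perturbations of the identity\<close>

text \<open>
  The two sequences enter in both orders below: with \<open>a = g\<close>, \<open>b = e\<close> this is the error
  operator of the Kaczmarz algorithm, with \<open>a = e\<close>, \<open>b = g\<close> its adjoint.
\<close>

definition deflate :: "(nat \<Rightarrow> 'a) \<Rightarrow> (nat \<Rightarrow> 'a) \<Rightarrow> nat \<Rightarrow> 'a \<Rightarrow> 'a :: complex_inner"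
  where "deflate a b n x = x - (\<Sum>i<n. cinner x (a i) *\<^sub>C b i)"

lemma deflate_0 [simp]: "deflate a b 0 x = x"
  by (simp add: deflate_def)

lemma deflate_Suc: "deflate a b (Suc n) x = deflate a b n x - cinner x (a n) *\<^sub>C b n"
  by (simp add: deflate_def)

lemma deflate_diff: "deflate a b n (x - y) = deflate a b n x - deflate a b n y"
  by (induction n)
    (simp_all add: deflate_Suc cinner_diff_left complex_vector.scale_left_diff_distrib)

lemma deflate_scaleC: "deflate a b n (c *\<^sub>C x) = c *\<^sub>C deflate a b n x"
  by (induction n)
    (simp_all add: deflate_Suc cinner_scaleC_left complex_vector.scale_right_diff_distrib
      scaleC_scaleC)

lemma deflate_cong: "(\<And>i. i < n \<Longrightarrow> a i = a' i) \<Longrightarrow> deflate a b n x = deflate a' b n x"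
  unfolding deflate_def by simp

lemma deflate_adjoint: "cinner (deflate a b n x) y = cinner x (deflate b a n y)"
proof (induction n)
  case (Suc n)
  have "cnj (cinner y (b n)) = cinner (b n) y"
    using cinner_commute[of "b n" y] by simp
  with Suc show ?case
    by (simp add: deflate_Suc cinner_diff_left cinner_diff_right cinner_scaleC_left
        cinner_scaleC_right)
qed simp

section \<open>Kaczmarz pairs\<close>

text \<open>
  Only the first \<open>n\<close> vectors are constrained, so that the notion also applies to the initial
  segments met while \<open>e\<close> is being constructed.
\<close>

definition kaczmarz_pair :: "(nat \<Rightarrow> 'a :: complex_inner) \<Rightarrow> (nat \<Rightarrow> 'a) \<Rightarrow> nat \<Rightarrow> bool"
  where "kaczmarz_pair e g n \<longleftrightarrow> (\<forall>i<n. norm (e i) = 1 \<and> deflate e g i (e i) = g i)"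

lemma kaczmarz_pair_mono: "kaczmarz_pair e g n \<Longrightarrow> m \<le> n \<Longrightarrow> kaczmarz_pair e g m"
  by (auto simp: kaczmarz_pair_def)

lemma kaczmarz_pair_iff_explicit:
  "(\<forall>n. kaczmarz_pair e g n) \<longleftrightarrow> (\<forall>n. norm (e n) = 1) \<and>
    g 0 = e 0 \<and> (\<forall>n\<ge>1. g n = e n - (\<Sum>i<n. cinner (e n) (e i) *\<^sub>C g i))"
proof -
  have "(\<forall>n. deflate e g n (e n) = g n) \<longleftrightarrow>
      g 0 = e 0 \<and> (\<forall>n\<ge>1. g n = e n - (\<Sum>i<n. cinner (e n) (e i) *\<^sub>C g i))"
    unfolding deflate_def by (metis (no_types, lifting) One_nat_def Suc_leI diff_zero lessThan_0
        neq0_conv sum.empty)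
  then show ?thesis
    unfolding kaczmarz_pair_def by (metis lessI)
qed

text \<open>
  The recursion in dual form: a frame coefficient of \<open>x\<close> is the coefficient by which the
  Kaczmarz algorithm corrects its current error.
\<close>

lemma cinner_frame_eq:
  assumes "kaczmarz_pair e g (Suc n)"
  shows "cinner x (g n) = cinner (deflate g e n x) (e n)"
  using assms by (simp add: kaczmarz_pair_def deflate_adjoint)

lemma deflate_residual_Suc:
  assumes "kaczmarz_pair e g (Suc n)"
  shows "deflate g e (Suc n) x
    = deflate g e n x - cinner (deflate g e n x) (e n) *\<^sub>C e n"
  by (simp add: deflate_Suc cinner_frame_eq[OF assms])

text \<open>
  The adjoint picks up the projection on the other side, because \<open>g\<^sub>n\<close> is itself the image of
  \<open>e\<^sub>n\<close>. In particular \<open>e\<^sub>n\<close> lies in the kernel of the operator of index \<open>n + 1\<close>.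
\<close>

lemma deflate_dual_Suc:
  assumes "kaczmarz_pair e g (Suc n)"
  shows "deflate e g (Suc n) v = deflate e g n (v - cinner v (e n) *\<^sub>C e n)"
  using assms by (simp add: kaczmarz_pair_def deflate_Suc deflate_diff deflate_scaleC)

text \<open>Pythagoras, applied to each projection step.\<close>

lemma norm_deflate_squared:
  assumes "kaczmarz_pair e g n"
  shows "(norm (deflate g e n x))\<^sup>2 = (norm x)\<^sup>2 - (\<Sum>i<n. (cmod (cinner x (g i)))\<^sup>2)"
  using assms
proof (induction n)
  case (Suc n)
  then have "norm (e n) = 1" "kaczmarz_pair e g n"
    by (auto simp: kaczmarz_pair_def)
  then show ?case
    using Suc
    by (simp add: deflate_residual_Suc[OF Suc.prems] norm_diff_projection_squared
        cinner_frame_eq[OF Suc.prems])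
qed simp

lemma kaczmarz_eq_deflate:
  assumes "\<And>n. kaczmarz_pair e g n"
  shows "kaczmarz e x n = x - deflate g e (Suc n) x"
proof (induction n)
  case 0
  then show ?case
    by (simp add: deflate_residual_Suc[OF assms])
next
  case (Suc n)
  then show ?case
    by (simp add: deflate_residual_Suc[OF assms, of "Suc n"])
qed

section \<open>Stable normalized tight frames\<close>

locale stable_tight_frame =
  fixes g :: "nat \<Rightarrow> 'a :: complex_inner"
  assumes tight: "normalized_tight_frame g"
    and norm_g0: "norm (g 0) = 1"
    and stable: "stable_frame g"
begin

lemma sums_frame: "(\<lambda>n. (cmod (cinner x (g n)))\<^sup>2) sums (norm x)\<^sup>2"
  using tight by (simp add: normalized_tight_frame_def)

text \<open>
  The initial vector alone already exhausts the frame identity at \<open>x = g\<^sub>0\<close>, as its own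
  coefficient is \<open>\<parallel>g\<^sub>0\<parallel>\<^sup>2 = 1\<close>.
\<close>

lemma cinner_g0_eq_0:
  assumes "n \<noteq> 0"
  shows "cinner (g 0) (g n) = 0"
proof -
  let ?f = "\<lambda>n. (cmod (cinner (g 0) (g n)))\<^sup>2"
  have "sum ?f {0, n} \<le> (norm (g 0))\<^sup>2"
    using sums_frame[of "g 0"] by (metis (no_types, lifting) sum_le_suminf finite.emptyI
        finite.insertI sums_summable sums_unique zero_le_power2)
  moreover have "cinner (g 0) (g 0) = 1"
    using norm_g0 by (simp add: norm_eq_1_iff_cinner)
  ultimately show ?thesis
    using assms norm_g0 by simp
qed

lemma frame_tail_sums_norm_deflate:
  assumes "kaczmarz_pair e g n"
  shows "(\<lambda>i. (cmod (cinner x (g (i + n))))\<^sup>2) sums (norm (deflate g e n x))\<^sup>2"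
  using sums_split_initial_segment[OF sums_frame] norm_deflate_squared[OF assms] by simp

lemma cmod_cinner_le_norm_deflate:
  assumes "kaczmarz_pair e g n" and "n \<le> m"
  shows "cmod (cinner x (g m)) \<le> norm (deflate g e n x)"
proof (rule power2_le_imp_le)
  have "(cmod (cinner x (g (m - n + n))))\<^sup>2 \<le> (norm (deflate g e n x))\<^sup>2"
    using frame_tail_sums_norm_deflate[OF assms(1), of x]
      sum_le_suminf[of "\<lambda>i. (cmod (cinner x (g (i + n))))\<^sup>2" "{m - n}"]
    by (simp add: sums_iff)
  then show "(cmod (cinner x (g m)))\<^sup>2 \<le> (norm (deflate g e n x))\<^sup>2"
    using assms(2) by simp
qed simp

text \<open>
  A vector without error after finitely many steps has no frame coefficients beyond them. Removing
  its component along \<open>g\<^sub>0\<close> makes it orthogonal to a set that is linearly dense by stability.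
\<close>

lemma kernel_deflate:
  assumes "kaczmarz_pair e g n" and "deflate g e n x = 0"
  shows "x = cinner x (g 0) *\<^sub>C g 0"
proof -
  let ?w = "x - cinner x (g 0) *\<^sub>C g 0"
  have "cinner s ?w = 0" if "s \<in> {g 0} \<union> g ` {Suc n..}" for s
  proof -
    have "cinner ?w (g 0) = 0"
      by (rule projection_residual_orthogonal[OF norm_g0])
    moreover have "cinner ?w (g m) = 0" if "m \<ge> Suc n" for m
      using cmod_cinner_le_norm_deflate[OF assms(1), of m x] assms(2) cinner_g0_eq_0[of m] that
      by (simp add: cinner_diff_left cinner_scaleC_left)
    ultimately show ?thesis
      using that cinner_eq_zero_commute by blast
  qed
  then have "?w = 0"
    using orthogonal_to_linearly_dense_eq_0 stable unfolding stable_frame_def by blast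
  then show ?thesis
    by (rule eq_iff_diff_eq_0[THEN iffD2])
qed

text \<open>
  The two operators are finite-rank perturbations of the identity and adjoint to each other, so
  their kernels have equal dimension and their ranges are the orthogonal complements of the
  kernels. The predicate records the case of dimension one, with the kernels spanned by \<open>e\<^sub>n\<close> and
  \<open>g\<^sub>0\<close>.
\<close>

definition one_dim_defect :: "(nat \<Rightarrow> 'a) \<Rightarrow> nat \<Rightarrow> bool"
  where "one_dim_defect e n \<longleftrightarrow>
    (\<forall>v. deflate e g (Suc n) v = 0 \<longrightarrow> (\<exists>c. v = c *\<^sub>C e n)) \<and>
    (\<forall>z. cinner z (e n) = 0 \<longrightarrow> (\<exists>x. deflate g e (Suc n) x = z)) \<and>
    (\<forall>y. cinner y (g 0) = 0 \<longrightarrow> (\<exists>v. deflate e g (Suc n) v = y))"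

text \<open>
  If \<open>e\<^sub>n\<^sub>+\<^sub>1\<close> were orthogonal to \<open>e\<^sub>n\<close>, it would be the error of some \<open>x\<close> after step \<open>n\<close>. The
  next step would then annihilate that error, so \<open>x\<close> would be a multiple of \<open>g\<^sub>0\<close>. But
  \<open>g\<^sub>0 = e\<^sub>0\<close> has error zero from the start, contradicting that \<open>e\<^sub>n\<^sub>+\<^sub>1\<close> is a unit vector.
\<close>

lemma consecutive_not_orthogonal:
  assumes pair: "kaczmarz_pair e g (Suc (Suc n))" and "one_dim_defect e n"
  shows "cinner (e n) (e (Suc n)) \<noteq> 0"
proof
  assume "cinner (e n) (e (Suc n)) = 0"
  then have "cinner (e (Suc n)) (e n) = 0"
    using cinner_eq_zero_commute by blast
  then obtain x where x: "deflate g e (Suc n) x = e (Suc n)"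
    using assms(2) unfolding one_dim_defect_def by blast
  have unit: "norm (e (Suc n)) = 1" and g0: "g 0 = e 0"
    using pair by (auto simp: kaczmarz_pair_def)
  have "deflate g e (Suc (Suc n)) x = 0"
    using unit by (simp add: deflate_residual_Suc[OF pair] x norm_eq_1_iff_cinner)
  then have x': "x = cinner x (g 0) *\<^sub>C g 0"
    by (rule kernel_deflate[OF pair])
  have "deflate g e (Suc n) (g 0) = 0"
  proof -
    let ?f = "\<lambda>i. (cmod (cinner (g 0) (g i)))\<^sup>2"
    have "cinner (g 0) (g 0) = 1"
      using norm_g0 by (simp add: norm_eq_1_iff_cinner)
    moreover have "?f 0 \<le> (\<Sum>i<Suc n. ?f i)"
      by (rule member_le_sum) auto
    moreover have "kaczmarz_pair e g (Suc n)"
      using pair by (rule kaczmarz_pair_mono) simp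
    ultimately have "(norm (deflate g e (Suc n) (g 0)))\<^sup>2 \<le> 0"
      using norm_g0 norm_deflate_squared[of e g "Suc n" "g 0"] by simp
    then show ?thesis
      by simp
  qed
  then have "deflate g e (Suc n) x = 0"
    by (subst x') (simp add: deflate_scaleC)
  then show False
    using x unit by simp
qed

text \<open>
  Passing to the next index composes \<open>B\<close> with the projection along \<open>e\<^sub>n\<^sub>+\<^sub>1\<close> on the left, and
  \<open>A\<close> with it on the right. Because \<open>\<langle>e\<^sub>n, e\<^sub>n\<^sub>+\<^sub>1\<rangle> \<noteq> 0\<close>, the line through one of the two vectors
  is a complement of the hyperplane orthogonal to the other, so kernel and ranges are carried over
  without growth of the defect.
\<close>

lemma one_dim_defect_step:
  assumes pair: "kaczmarz_pair e g (Suc (Suc n))" and defect: "one_dim_defect e n"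
  shows "one_dim_defect e (Suc n)"
proof -
  have nz: "cinner (e n) (e (Suc n)) \<noteq> 0"
    by (rule consecutive_not_orthogonal[OF assms])
  have unit: "norm (e (Suc n)) = 1" and unit': "norm (e n) = 1"
    and dual: "deflate e g n (e n) = g n"
    using pair by (auto simp: kaczmarz_pair_def)
  have dual0: "deflate e g (Suc n) (e n) = 0"
    using unit' dual by (simp add: deflate_Suc norm_eq_1_iff_cinner)
  \<comment> \<open>The projected \<open>v\<close> lies on the line through \<open>e n\<close>, which meets the orthogonal complement
    of \<open>e (Suc n)\<close> only in 0.\<close>
  have "\<exists>c. v = c *\<^sub>C e (Suc n)" if "deflate e g (Suc (Suc n)) v = 0" for v
  proof -
    let ?w = "v - cinner v (e (Suc n)) *\<^sub>C e (Suc n)"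
    have "deflate e g (Suc n) ?w = 0"
      using that by (simp only: deflate_dual_Suc[OF pair])
    then obtain c where c: "?w = c *\<^sub>C e n"
      using defect unfolding one_dim_defect_def by blast
    have "cinner ?w (e (Suc n)) = 0"
      by (rule projection_residual_orthogonal[OF unit])
    then have "c = 0"
      using nz by (simp add: c cinner_scaleC_left)
    then have "?w = 0"
      by (simp only: c complex_vector.scale_zero_left)
    then have "v = cinner v (e (Suc n)) *\<^sub>C e (Suc n)"
      by (rule eq_iff_diff_eq_0[THEN iffD2])
    then show ?thesis ..
  qed
  \<comment> \<open>A multiple of \<open>e (Suc n)\<close> moves \<open>z\<close> into the previous range; the projection removes it
    again.\<close>
  moreover have "\<exists>x. deflate g e (Suc (Suc n)) x = z" if "cinner z (e (Suc n)) = 0" for z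
  proof -
    have "cinner (e (Suc n)) (e n) \<noteq> 0"
      using nz cinner_eq_zero_commute by blast
    then obtain c where "cinner (z - c *\<^sub>C e (Suc n)) (e n) = 0"
      using ex_orthogonal_correction by blast
    then obtain x where "deflate g e (Suc n) x = z - c *\<^sub>C e (Suc n)"
      using defect unfolding one_dim_defect_def by blast
    then have "deflate g e (Suc (Suc n)) x = z"
      using that unit unfolding deflate_residual_Suc[OF pair]
      by (simp add: cinner_diff_left cinner_scaleC_left norm_eq_1_iff_cinner)
    then show ?thesis ..
  qed
  \<comment> \<open>Preimages may be changed by multiples of \<open>e n\<close>, hence chosen in the orthogonal complement
    of \<open>e (Suc n)\<close>, on which the projection is the identity.\<close>
  moreover have "\<exists>v. deflate e g (Suc (Suc n)) v = y" if "cinner y (g 0) = 0" for y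
  proof -
    obtain v where v: "deflate e g (Suc n) v = y"
      using \<open>cinner y (g 0) = 0\<close> defect unfolding one_dim_defect_def by blast
    obtain c where "cinner (v - c *\<^sub>C e n) (e (Suc n)) = 0"
      using ex_orthogonal_correction[OF nz] by blast
    then have "deflate e g (Suc (Suc n)) (v - c *\<^sub>C e n) = y"
      unfolding deflate_dual_Suc[OF pair] by (simp add: deflate_diff deflate_scaleC dual0 v)
    then show ?thesis ..
  qed
  ultimately show ?thesis
    unfolding one_dim_defect_def by blast
qed

lemma one_dim_defect:
  assumes "kaczmarz_pair e g (Suc n)"
  shows "one_dim_defect e n"
  using assms
proof (induction n)
  case 0
  then have "e 0 = g 0"
    by (simp add: kaczmarz_pair_def)
  have "v = cinner v (g 0) *\<^sub>C g 0" if "deflate e g (Suc 0) v = 0" for v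
    using that \<open>e 0 = g 0\<close> unfolding deflate_Suc deflate_0 by (metis eq_iff_diff_eq_0)
  moreover have "deflate e g (Suc 0) z = z \<and> deflate g e (Suc 0) z = z"
    if "cinner z (g 0) = 0" for z
    using that \<open>e 0 = g 0\<close> by (simp add: deflate_Suc)
  ultimately show ?case
    unfolding one_dim_defect_def \<open>e 0 = g 0\<close> by blast
next
  case (Suc n)
  then show ?case
    by (meson one_dim_defect_step kaczmarz_pair_mono le_SucI order_refl)
qed

section \<open>Existence and uniqueness of the next vector\<close>

text \<open>
  The solution \<open>y\<close> orthogonal to \<open>e\<^sub>n\<close> has the form \<open>B\<^sub>n\<^sub>+\<^sub>1 u\<close>, so adjointness turns \<open>\<parallel>y\<parallel>\<^sup>2\<close> into
  the single frame coefficient \<open>\<langle>u, g\<^sub>n\<^sub>+\<^sub>1\<rangle>\<close>. That coefficient is bounded by the norm of the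
  error \<open>B\<^sub>n\<^sub>+\<^sub>1 u = y\<close>, which gives \<open>\<parallel>y\<parallel>\<^sup>2 \<le> \<parallel>y\<parallel>\<close> and leaves room for a nonnegative multiple of
  \<open>e\<^sub>n\<close>.
\<close>

lemma ex_next_vector:
  assumes pair: "kaczmarz_pair e g (Suc n)"
  shows "\<exists>r. norm r = 1 \<and> deflate e g (Suc n) r = g (Suc n) \<and> cinner (e n) r \<in> \<real>\<^sub>\<ge>\<^sub>0"
proof -
  have defect: "one_dim_defect e n"
    by (rule one_dim_defect[OF pair])
  have unit: "norm (e n) = 1" and dual: "deflate e g n (e n) = g n"
    using pair by (auto simp: kaczmarz_pair_def)
  have ee: "cinner (e n) (e n) = 1"
    using unit by (simp add: norm_eq_1_iff_cinner)
  have dual0: "deflate e g (Suc n) (e n) = 0"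
    using ee dual by (simp add: deflate_Suc)
  have "cinner (g (Suc n)) (g 0) = 0"
    using cinner_g0_eq_0[of "Suc n"] cinner_eq_zero_commute by blast
  then obtain v where v: "deflate e g (Suc n) v = g (Suc n)"
    using defect unfolding one_dim_defect_def by blast
  define y where "y = v - cinner v (e n) *\<^sub>C e n"
  have y_orth: "cinner y (e n) = 0"
    unfolding y_def by (rule projection_residual_orthogonal[OF unit])
  have Ay: "deflate e g (Suc n) y = g (Suc n)"
    by (simp add: y_def deflate_diff deflate_scaleC dual0 v)
  obtain u where u: "deflate g e (Suc n) u = y"
    using y_orth defect unfolding one_dim_defect_def by blast
  have "cinner y y = cinner u (g (Suc n))"
    using deflate_adjoint[of g e "Suc n" u y] by (simp add: u Ay)
  then have "(norm y)\<^sup>2 = cmod (cinner u (g (Suc n)))"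
    by (metis cinner_self norm_of_real abs_power2)
  also have "\<dots> \<le> norm y"
    using cmod_cinner_le_norm_deflate[OF pair, of "Suc n" u] by (simp add: u)
  finally have "norm y \<le> 1"
    by (cases "y = 0") (simp_all add: power2_eq_square mult_le_cancel_left2)
  define c where "c = sqrt (1 - (norm y)\<^sup>2)"
  define r where "r = y + complex_of_real c *\<^sub>C e n"
  have c: "c \<ge> 0" "c\<^sup>2 = 1 - (norm y)\<^sup>2"
    using \<open>norm y \<le> 1\<close> by (auto simp: c_def abs_square_le_1)
  have en_y: "cinner (e n) y = 0"
    using y_orth cinner_eq_zero_commute by blast
  have "cinner r r = cinner y y + complex_of_real (c\<^sup>2)"
    by (simp add: r_def cinner_add_left cinner_add_right cinner_scaleC_left cinner_scaleC_right
        y_orth en_y ee power2_eq_square)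
  also have "\<dots> = 1"
    by (simp add: cinner_self c(2))
  finally have "norm r = 1"
    by (simp add: norm_eq_1_iff_cinner)
  moreover have "deflate e g (Suc n) r = g (Suc n)"
    using deflate_diff[of e g "Suc n" r "complex_of_real c *\<^sub>C e n"]
    by (simp add: r_def deflate_scaleC dual0 Ay)
  moreover have "cinner (e n) r \<in> \<real>\<^sub>\<ge>\<^sub>0"
    using c(1) by (simp add: r_def cinner_add_right cinner_scaleC_right en_y ee)
  ultimately show ?thesis
    by blast
qed

text \<open>
  Two solutions differ by a multiple of \<open>e\<^sub>n\<close>, so they share the component orthogonal to \<open>e\<^sub>n\<close>.
  Equal norms then fix the modulus of the remaining coefficient, and admissibility its argument.
\<close>

lemma next_vector_unique:
  assumes pair: "kaczmarz_pair e g (Suc n)"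
    and r: "norm r = 1" "deflate e g (Suc n) r = g (Suc n)" "cinner (e n) r \<in> \<real>\<^sub>\<ge>\<^sub>0"
    and s: "norm s = 1" "deflate e g (Suc n) s = g (Suc n)" "cinner (e n) s \<in> \<real>\<^sub>\<ge>\<^sub>0"
  shows "r = s"
proof -
  have unit: "norm (e n) = 1"
    using pair by (auto simp: kaczmarz_pair_def)
  have "deflate e g (Suc n) (r - s) = 0"
    by (simp add: deflate_diff r s)
  then obtain c where c: "r - s = c *\<^sub>C e n"
    using one_dim_defect[OF pair] unfolding one_dim_defect_def by blast
  have "cinner r (e n) - cinner s (e n) = cinner (r - s) (e n)"
    by (simp only: cinner_diff_left)
  also have "\<dots> = c"
    using unit by (simp add: c cinner_scaleC_left norm_eq_1_iff_cinner)
  finally have diff: "r - s = (cinner r (e n) - cinner s (e n)) *\<^sub>C e n"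
    using c by (simp only:)
  have "(r - cinner r (e n) *\<^sub>C e n) - (s - cinner s (e n) *\<^sub>C e n)
      = (r - s) - (cinner r (e n) - cinner s (e n)) *\<^sub>C e n"
    by (simp add: complex_vector.scale_left_diff_distrib)
  also have "\<dots> = 0"
    by (subst diff) (rule diff_self)
  finally have "r - cinner r (e n) *\<^sub>C e n = s - cinner s (e n) *\<^sub>C e n"
    by (rule eq_iff_diff_eq_0[THEN iffD2])
  then have "(cmod (cinner r (e n)))\<^sup>2 = (cmod (cinner s (e n)))\<^sup>2"
    using norm_diff_projection_squared[OF unit, of r] norm_diff_projection_squared[OF unit, of s]
      r(1) s(1) by simp
  then have "cmod (cinner (e n) r) = cmod (cinner (e n) s)"
    by (simp add: cmod_cinner_commute)
  then have "cinner (e n) r = cinner (e n) s"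
    using r(3) s(3) by (auto elim!: nonneg_Reals_cases)
  then have "cinner r (e n) = cinner s (e n)"
    by (metis cinner_commute)
  then have "r - s = 0"
    by (subst diff) simp
  then show ?thesis
    by simp
qed

lemma ex_admissible_kaczmarz_pair:
  "\<exists>e. (\<forall>n. kaczmarz_pair e g n) \<and> admissible_sequence e"
proof -
  \<comment> \<open>For \<open>n = 0\<close> the equation reads \<open>r = g 0\<close>, so the first vector needs no separate clause.\<close>
  define P where "P = (\<lambda>e n r. norm r = 1 \<and> deflate e g n r = g n \<and>
    (\<forall>m. n = Suc m \<longrightarrow> cinner (e m) r \<in> \<real>\<^sub>\<ge>\<^sub>0))"
  have "\<exists>e. \<forall>n. P e n (e n)"
  proof (rule dependent_wellorder_choice)
    show "P e n r = P e' n r" if "\<And>m. m < n \<Longrightarrow> e m = e' m" for r e e' n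
      using that deflate_cong[of n e e' g r] unfolding P_def by auto
  next
    fix n e assume prev: "\<And>m. m < n \<Longrightarrow> P e m (e m)"
    show "\<exists>r. P e n r"
    proof (cases n)
      case 0
      then show ?thesis
        using norm_g0 by (auto simp: P_def)
    next
      case (Suc m)
      then have "kaczmarz_pair e g (Suc m)"
        using prev by (auto simp: kaczmarz_pair_def P_def)
      then show ?thesis
        using ex_next_vector by (auto simp: P_def Suc)
    qed
  qed
  then show ?thesis
    unfolding P_def kaczmarz_pair_def admissible_sequence_def by blast
qed

lemma admissible_kaczmarz_pair_unique:
  assumes e: "\<And>n. kaczmarz_pair e g n" "admissible_sequence e"
    and e': "\<And>n. kaczmarz_pair e' g n" "admissible_sequence e'"
  shows "e' = e"
proof
  fix n
  show "e' n = e n"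
  proof (induction n rule: less_induct)
    case (less n)
    have step: "norm (e n) = 1" "deflate e g n (e n) = g n"
      "norm (e' n) = 1" "deflate e' g n (e' n) = g n"
      using e(1)[of "Suc n"] e'(1)[of "Suc n"] by (auto simp: kaczmarz_pair_def)
    have same: "deflate e' g n (e' n) = deflate e g n (e' n)"
      by (rule deflate_cong) (rule less)
    show ?case
    proof (cases n)
      case 0
      then show ?thesis
        using step by simp
    next
      case (Suc m)
      have "cinner (e m) (e n) \<in> \<real>\<^sub>\<ge>\<^sub>0" "cinner (e m) (e' n) \<in> \<real>\<^sub>\<ge>\<^sub>0"
        using e(2) e'(2) less[of m] Suc unfolding admissible_sequence_def by (metis lessI)+
      then show ?thesis
        using next_vector_unique[OF e(1)[of "Suc m"]] step same Suc by metis
    qed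
  qed
qed

section \<open>Effectivity and stability\<close>

lemma deflate_tendsto_0:
  assumes "\<And>n. kaczmarz_pair e g n"
  shows "(\<lambda>n. deflate g e n x) \<longlonglongrightarrow> 0"
proof -
  have "(\<lambda>n. (norm x)\<^sup>2 - (\<Sum>i<n. (cmod (cinner x (g i)))\<^sup>2)) \<longlonglongrightarrow> (norm x)\<^sup>2 - (norm x)\<^sup>2"
    using sums_frame[of x] by (intro tendsto_diff tendsto_const) (simp add: sums_def)
  then have "(\<lambda>n. (norm (deflate g e n x))\<^sup>2) \<longlonglongrightarrow> 0"
    by (simp add: norm_deflate_squared[OF assms])
  then show ?thesis
    by (simp add: tendsto_norm_zero_iff)
qed

text \<open>
  The error after the first \<open>N\<close> steps is the sum of all later corrections. The extra multiple of
  \<open>e\<^sub>N\<close> makes up for the missing direction when only vectors orthogonal to \<open>e\<^sub>N\<^sub>-\<^sub>1\<close> occur as errors.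
\<close>

lemma deflate_in_closure_span_tail:
  assumes "\<And>n. kaczmarz_pair e g n"
  shows "deflate g e N x + c *\<^sub>C e N \<in> closure (complex_vector.span (e ` {N..}))"
proof -
  define s where "s k = deflate g e N x - deflate g e (N + k) x + c *\<^sub>C e N" for k
  have "s k \<in> complex_vector.span (e ` {N..})" for k
  proof (induction k)
    case 0
    then show ?case
      by (auto simp: s_def intro: complex_vector.span_scale complex_vector.span_base)
  next
    case (Suc k)
    have "s (Suc k) = s k + cinner x (g (N + k)) *\<^sub>C e (N + k)"
      by (simp add: s_def deflate_Suc)
    moreover have "e (N + k) \<in> e ` {N..}"
      by simp
    ultimately show ?case
      using Suc by (simp only: complex_vector.span_add complex_vector.span_scale
          complex_vector.span_base)
  qed
  moreover have "s \<longlonglongrightarrow> deflate g e N x - 0 + c *\<^sub>C e N"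
    unfolding s_def
    using LIMSEQ_ignore_initial_segment[OF deflate_tendsto_0[OF assms, of x], of N]
    by (intro tendsto_intros) (simp add: add.commute)
  ultimately show ?thesis
    unfolding closure_sequential by auto
qed

lemma stable_sequence_if_kaczmarz_pair:
  assumes "\<And>n. kaczmarz_pair e g n"
  shows "stable_sequence e"
proof -
  have "v \<in> closure (complex_vector.span (e ` {N..}))" for N v
  proof (cases N)
    case 0
    then show ?thesis
      using deflate_in_closure_span_tail[OF assms, of 0 v 0] by simp
  next
    case (Suc m)
    have "cinner (e (Suc m)) (e m) \<noteq> 0"
      using consecutive_not_orthogonal[OF assms one_dim_defect[OF assms], of m]
        cinner_eq_zero_commute by blast
    then obtain c where "cinner (v - c *\<^sub>C e (Suc m)) (e m) = 0"
      using ex_orthogonal_correction by blast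
    then obtain x where "deflate g e (Suc m) x = v - c *\<^sub>C e (Suc m)"
      using one_dim_defect[OF assms] unfolding one_dim_defect_def by blast
    then show ?thesis
      using deflate_in_closure_span_tail[OF assms, of "Suc m" x c] Suc by simp
  qed
  then show ?thesis
    unfolding stable_sequence_def linearly_dense_def by blast
qed

lemma effective_sequence_if_kaczmarz_pair:
  assumes "\<And>n. kaczmarz_pair e g n"
  shows "effective_sequence e"
proof -
  have "(\<lambda>n. kaczmarz e x n) \<longlonglongrightarrow> x" for x
    using tendsto_diff[OF tendsto_const LIMSEQ_Suc[OF deflate_tendsto_0[OF assms]]]
    by (simp add: kaczmarz_eq_deflate[OF assms])
  moreover have "linearly_dense (range e)"
    using stable_sequence_if_kaczmarz_pair[OF assms] unfolding stable_sequence_def by (metis atLeast_0)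
  ultimately show ?thesis
    by (simp add: effective_sequence_def)
qed

end

theorem corollary2:
  fixes g :: "nat \<Rightarrow> 'a::chilbert_space"
  assumes "normalized_tight_frame g"
    and "norm (g 0) = 1"
    and "stable_frame g"
  shows "\<exists>e :: nat \<Rightarrow> 'a.
    ((\<forall>n. norm (e n) = 1) \<and> admissible_sequence e \<and> effective_sequence e \<and>
      g 0 = e 0 \<and> (\<forall>n\<ge>1. g n = e n - (\<Sum>i<n. cinner (e n) (e i) *\<^sub>C g i))) \<and>
    (\<forall>e' :: nat \<Rightarrow> 'a.
      (\<forall>n. norm (e' n) = 1) \<and> admissible_sequence e' \<and> effective_sequence e' \<and>
      g 0 = e' 0 \<and> (\<forall>n\<ge>1. g n = e' n - (\<Sum>i<n. cinner (e' n) (e' i) *\<^sub>C g i)) \<longrightarrow> e' = e) \<and>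
    stable_sequence e"
proof -
  interpret stable_tight_frame g
    using assms by unfold_locales
  obtain e where e: "\<And>n. kaczmarz_pair e g n" "admissible_sequence e"
    using ex_admissible_kaczmarz_pair by blast
  have "e' = e" if "(\<forall>n. norm (e' n) = 1) \<and> admissible_sequence e' \<and> effective_sequence e' \<and>
      g 0 = e' 0 \<and> (\<forall>n\<ge>1. g n = e' n - (\<Sum>i<n. cinner (e' n) (e' i) *\<^sub>C g i))" for e'
    using that admissible_kaczmarz_pair_unique[OF e, of e'] kaczmarz_pair_iff_explicit[of e' g]
    by blast
  moreover have "(\<forall>n. norm (e n) = 1) \<and>
      g 0 = e 0 \<and> (\<forall>n\<ge>1. g n = e n - (\<Sum>i<n. cinner (e n) (e i) *\<^sub>C g i))"
    using e(1) kaczmarz_pair_iff_explicit[of e g] by blast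
  ultimately show ?thesis
    using e(2) effective_sequence_if_kaczmarz_pair[OF e(1)] stable_sequence_if_kaczmarz_pair[OF e(1)] by blast
qed

end
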